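(* Let a set $S$ of stores with parameters $(E_i,Q_i,P_i,\eta_i)_{i\in S}$ and initial levels $s(0)=(s_i(0),\,i\in S)$ with $0\le s_i(0)\le E_i$ be given. Any feasible policy may be modified to be greedy while remaining feasible and while continuing to serve at least as much energy to each successive time (that is, for every time $t\ge1$, the total unserved energy $\mathit{ue}(t)$ to time $t$ under the modified policy is no greater than that under the original policy). Further, if the original policy is non-anticipatory, the modified policy may be taken to be non-anticipatory.
   Context: Time $t$ is discrete. $S$ is a finite set of stores. Each store $i\in S$ has capacity $E_i>0$, maximum output rate $P_i>0$, maximum input rate $Q_i>0$ and round-trip efficiency $\eta_i\in(0,1]$ (all losses are accounted for at input). The level of energy in store $i$ at the end of time $t$ is $s_i(t)$, and $s_i(0)$ is the given initial level; $s(t)=(s_i(t),\,i\in S)$. The residual energy process is a real-valued process $(\mathit{re}(t),\,t\ge1)$, not generally known in advance; positive values are surplus energy available for charging and negative values are demand to be met as far as possible from the stores. A policy is a specification of the rate vectors $r(t)=(r_i(t),\,i\in S)$ for all $t\ge1$, with store levels determined by $$s_i(t)=s_i(t-1)+r_i(t),\qquad t\ge1.$$ The imbalance at time $t$ is $$u(t)=\mathit{re}(t)-\Bigl(\sum_{i:\,r_i(t)<0}r_i(t)+\sum_{i:\,r_i(t)\ge0}r_i(t)/\eta_i\Bigr).$$ A policy is feasible if, for all $t\ge1$ and $i\in S$: $0\le s_i(t)\le E_i$; $-P_i\le r_i(t)\le\eta_iQ_i$; $\mathit{re}(t)\ge0\Rightarrow u(t)\ge0$; and $\mathit{re}(t)\le0\Rightarrow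 u(t)\le0$. (A feasible policy may have some stores charging while others discharge at the same time.) For a feasible policy, the total unserved energy to time $t$ is $\mathit{ue}(t)=\sum_{t'\le t}\max(0,-u(t'))$. A greedy policy is a feasible policy in which, at each time $t\ge1$, given the levels $s(t-1)$: (i) if $\mathit{re}(t)\ge0$, there is no possibility to increase any of the rates $r_i(t)$, $i\in S$ (without decreasing any of the others), while keeping the policy feasible (at time $t$); (ii) if $\mathit{re}(t)<0$, there is no possibility to decrease any of the rates $r_i(t)$, $i\in S$ (without increasing any of the others), while keeping the policy feasible (at time $t$). A policy is non-anticipatory (or without foresight) if the decision made at any time $t$, i.e. the choice of the rates vector $r(t)$, depends only on $s(t-1)$ and $\mathit{re}(t)$.
   Formalization: The last claim is false if the modified policy may use only its own levels s(t-1) and re(t); it is proved instead with r(t) depending on re(t) and on the time t-1 levels of both the modified and the original policy (run alongside). *)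

theory Defs
  imports Complex_Main
begin

text \<open>
  A rate plan \<open>r\<close> gives the rate \<open>r t i\<close> of store \<open>i\<close> at time \<open>t \<ge> 1\<close>; the values \<open>r 0\<close> and
  \<open>re 0\<close> are never used.  A policy maps each realisation \<open>re\<close> of the residual energy
  process to a rate plan.
\<close>

type_synonym 'i plan = "nat \<Rightarrow> 'i \<Rightarrow> real"
type_synonym 'i policy = "(nat \<Rightarrow> real) \<Rightarrow> 'i plan"

primrec level :: "('i \<Rightarrow> real) \<Rightarrow> 'i plan \<Rightarrow> nat \<Rightarrow> 'i \<Rightarrow> real" where
  "level s0 r 0 = s0"
| "level s0 r (Suc t) = (\<lambda>i. level s0 r t i + r (Suc t) i)"

definition imbalance :: "'i set \<Rightarrow> ('i \<Rightarrow> real) \<Rightarrow> real \<Rightarrow> ('i \<Rightarrow> real) \<Rightarrow> real" where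
  "imbalance S \<eta> e \<rho> =
     e - ((\<Sum>i\<in>{i\<in>S. \<rho> i < 0}. \<rho> i) + (\<Sum>i\<in>{i\<in>S. \<rho> i \<ge> 0}. \<rho> i / \<eta> i))"

text \<open>
  The feasibility constraints at a single time: \<open>x\<close> are the levels at the end of the previous
  period, \<open>e\<close> is the current residual energy and \<open>\<rho>\<close> the vector of current rates.
\<close>

definition feasible_step ::
  "'i set \<Rightarrow> ('i \<Rightarrow> real) \<Rightarrow> ('i \<Rightarrow> real) \<Rightarrow> ('i \<Rightarrow> real) \<Rightarrow> ('i \<Rightarrow> real)
     \<Rightarrow> ('i \<Rightarrow> real) \<Rightarrow> real \<Rightarrow> ('i \<Rightarrow> real) \<Rightarrow> bool" where
  "feasible_step S E P Q \<eta> x e \<rho> \<longleftrightarrow>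
     (\<forall>i\<in>S. 0 \<le> x i + \<rho> i \<and> x i + \<rho> i \<le> E i) \<and>
     (\<forall>i\<in>S. - P i \<le> \<rho> i \<and> \<rho> i \<le> \<eta> i * Q i) \<and>
     (e \<ge> 0 \<longrightarrow> imbalance S \<eta> e \<rho> \<ge> 0) \<and>
     (e \<le> 0 \<longrightarrow> imbalance S \<eta> e \<rho> \<le> 0)"

definition feasible_plan ::
  "'i set \<Rightarrow> ('i \<Rightarrow> real) \<Rightarrow> ('i \<Rightarrow> real) \<Rightarrow> ('i \<Rightarrow> real) \<Rightarrow> ('i \<Rightarrow> real)
     \<Rightarrow> ('i \<Rightarrow> real) \<Rightarrow> (nat \<Rightarrow> real) \<Rightarrow> 'i plan \<Rightarrow> bool" where
  "feasible_plan S E P Q \<eta> s0 re r \<longleftrightarrow>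
     (\<forall>t\<ge>1. feasible_step S E P Q \<eta> (level s0 r (t - 1)) (re t) (r t))"

definition greedy_plan ::
  "'i set \<Rightarrow> ('i \<Rightarrow> real) \<Rightarrow> ('i \<Rightarrow> real) \<Rightarrow> ('i \<Rightarrow> real) \<Rightarrow> ('i \<Rightarrow> real)
     \<Rightarrow> ('i \<Rightarrow> real) \<Rightarrow> (nat \<Rightarrow> real) \<Rightarrow> 'i plan \<Rightarrow> bool" where
  "greedy_plan S E P Q \<eta> s0 re r \<longleftrightarrow>
     feasible_plan S E P Q \<eta> s0 re r \<and>
     (\<forall>t\<ge>1.
        (re t \<ge> 0 \<longrightarrow>
           \<not> (\<exists>\<rho>. feasible_step S E P Q \<eta> (level s0 r (t - 1)) (re t) \<rho> \<and>
                 (\<forall>i\<in>S. r t i \<le> \<rho> i) \<and> (\<exists>i\<in>S. r t i < \<rho> i))) \<and>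
        (re t < 0 \<longrightarrow>
           \<not> (\<exists>\<rho>. feasible_step S E P Q \<eta> (level s0 r (t - 1)) (re t) \<rho> \<and>
                 (\<forall>i\<in>S. \<rho> i \<le> r t i) \<and> (\<exists>i\<in>S. \<rho> i < r t i))))"

definition unserved :: "'i set \<Rightarrow> ('i \<Rightarrow> real) \<Rightarrow> (nat \<Rightarrow> real) \<Rightarrow> 'i plan \<Rightarrow> nat \<Rightarrow> real" where
  "unserved S \<eta> re r t = (\<Sum>t'=1..t. max 0 (- imbalance S \<eta> (re t') (r t')))"

text \<open>
  \<open>R\<close> is the set of possible realisations of the residual energy process.
\<close>

definition feasible_policy ::
  "'i set \<Rightarrow> ('i \<Rightarrow> real) \<Rightarrow> ('i \<Rightarrow> real) \<Rightarrow> ('i \<Rightarrow> real) \<Rightarrow> ('i \<Rightarrow> real)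
     \<Rightarrow> ('i \<Rightarrow> real) \<Rightarrow> (nat \<Rightarrow> real) set \<Rightarrow> 'i policy \<Rightarrow> bool" where
  "feasible_policy S E P Q \<eta> s0 R \<pi> \<longleftrightarrow> (\<forall>re\<in>R. feasible_plan S E P Q \<eta> s0 re (\<pi> re))"

definition greedy_policy ::
  "'i set \<Rightarrow> ('i \<Rightarrow> real) \<Rightarrow> ('i \<Rightarrow> real) \<Rightarrow> ('i \<Rightarrow> real) \<Rightarrow> ('i \<Rightarrow> real)
     \<Rightarrow> ('i \<Rightarrow> real) \<Rightarrow> (nat \<Rightarrow> real) set \<Rightarrow> 'i policy \<Rightarrow> bool" where
  "greedy_policy S E P Q \<eta> s0 R \<pi> \<longleftrightarrow> (\<forall>re\<in>R. greedy_plan S E P Q \<eta> s0 re (\<pi> re))"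

text \<open>
  At every time \<open>t\<close> the rates chosen by \<open>\<pi>\<close> are a function of \<open>re t\<close> and of the levels
  at the end of time \<open>t - 1\<close> that result from the policies in \<open>Obs\<close>.
\<close>

definition nonanticipatory_wrt ::
  "'i set \<Rightarrow> ('i \<Rightarrow> real) \<Rightarrow> (nat \<Rightarrow> real) set \<Rightarrow> 'i policy set \<Rightarrow> 'i policy \<Rightarrow> bool" where
  "nonanticipatory_wrt S s0 R Obs \<pi> \<longleftrightarrow>
     (\<forall>t\<ge>1. \<forall>re\<in>R. \<forall>re'\<in>R.
        re t = re' t \<and>
        (\<forall>\<sigma>\<in>Obs. \<forall>i\<in>S. level s0 (\<sigma> re) (t - 1) i = level s0 (\<sigma> re') (t - 1) i)
        \<longrightarrow> (\<forall>i\<in>S. \<pi> re t i = \<pi> re' t i))"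

definition nonanticipatory ::
  "'i set \<Rightarrow> ('i \<Rightarrow> real) \<Rightarrow> (nat \<Rightarrow> real) set \<Rightarrow> 'i policy \<Rightarrow> bool" where
  "nonanticipatory S s0 R \<pi> \<longleftrightarrow> nonanticipatory_wrt S s0 R {\<pi>} \<pi>"

text \<open>
  A modification \<open>\<pi>'\<close> of \<open>\<pi>\<close> is without foresight if its decision at time \<open>t\<close> depends only on
  \<open>re t\<close> and on the levels at the end of time \<open>t - 1\<close>, both its own and those which \<open>\<pi>\<close>, run
  alongside, would have reached.  The latter cannot be dropped in general: two histories that lead
  \<open>\<pi>\<close> to different levels, and hence to different later decisions, may lead every greedy policy
  to the same levels (for instance, to all stores full).  No foresight enters
  through the levels of \<open>\<pi>\<close>: if \<open>\<pi>\<close> is nonanticipatory, then \<open>\<pi>'\<close> is determined by the residual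
  energies observed so far, as \<open>nonanticipatory_modification_causal\<close> shows.
\<close>

definition nonanticipatory_modification ::
  "'i set \<Rightarrow> ('i \<Rightarrow> real) \<Rightarrow> (nat \<Rightarrow> real) set \<Rightarrow> 'i policy \<Rightarrow> 'i policy \<Rightarrow> bool" where
  "nonanticipatory_modification S s0 R \<pi> \<pi>' \<longleftrightarrow> nonanticipatory_wrt S s0 R {\<pi>, \<pi>'} \<pi>'"

lemma level_cong:
  assumes "\<And>k. 1 \<le> k \<Longrightarrow> k \<le> n \<Longrightarrow> r k i = r' k i"
  shows "level s0 r n i = level s0 r' n i"
  using assms by (induction n) auto

lemma nonanticipatory_modification_causal:
  assumes "nonanticipatory S s0 R \<pi>" "nonanticipatory_modification S s0 R \<pi> \<pi>'"
    and "re \<in> R" "re' \<in> R" "\<And>k. 1 \<le> k \<Longrightarrow> k \<le> t \<Longrightarrow> re k = re' k" "1 \<le> t" "i \<in> S"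
  shows "\<pi>' re t i = \<pi>' re' t i"
proof -
  have na: "\<pi> re t i = \<pi> re' t i"
    if "1 \<le> t" "re t = re' t" "i \<in> S"
      "\<forall>i\<in>S. level s0 (\<pi> re) (t - 1) i = level s0 (\<pi> re') (t - 1) i" for t i
    using assms(1,3,4) that unfolding nonanticipatory_def nonanticipatory_wrt_def by blast
  have na': "\<pi>' re t i = \<pi>' re' t i"
    if "1 \<le> t" "re t = re' t" "i \<in> S"
      "\<forall>i\<in>S. level s0 (\<pi> re) (t - 1) i = level s0 (\<pi> re') (t - 1) i"
      "\<forall>i\<in>S. level s0 (\<pi>' re) (t - 1) i = level s0 (\<pi>' re') (t - 1) i" for t i
    using assms(2,3,4) that unfolding nonanticipatory_modification_def nonanticipatory_wrt_def
    by blast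
  have "t \<ge> 1 \<longrightarrow> (\<forall>k. 1 \<le> k \<and> k \<le> t \<longrightarrow> re k = re' k) \<longrightarrow>
          (\<forall>i\<in>S. \<pi> re t i = \<pi> re' t i \<and> \<pi>' re t i = \<pi>' re' t i)" for t
  proof (induction t rule: less_induct)
    case (less t)
    show ?case
    proof (intro impI)
      assume t: "1 \<le> t" and eq: "\<forall>k. 1 \<le> k \<and> k \<le> t \<longrightarrow> re k = re' k"
      have IH: "\<pi> re k i = \<pi> re' k i \<and> \<pi>' re k i = \<pi>' re' k i"
        if "1 \<le> k" "k \<le> t - 1" "i \<in> S" for k i
        using less[of k] that eq t by simp
      have "\<forall>i\<in>S. level s0 (\<pi> re) (t - 1) i = level s0 (\<pi> re') (t - 1) i"
        using IH by (meson level_cong)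
      moreover have "\<forall>i\<in>S. level s0 (\<pi>' re) (t - 1) i = level s0 (\<pi>' re') (t - 1) i"
        using IH by (meson level_cong)
      moreover have "re t = re' t" using eq t by blast
      ultimately show "\<forall>i\<in>S. \<pi> re t i = \<pi> re' t i \<and> \<pi>' re t i = \<pi>' re' t i"
        using na[OF t] na'[OF t] by blast
    qed
  qed
  then show ?thesis using assms by blast
qed

end

theory Submission
  imports Defs
begin

text \<open>
  The modified policy runs alongside the original one and is allowed to hold less energy than it
  only to the extent that it has already served more.  Let \<open>x\<close> and \<open>y\<close> be the levels under the
  original and the modified policy, and call \<open>\<Sum>i\<in>S. max 0 (x i - y i)\<close> the deficit.  The
  invariant (\<open>greedy_modification_invariant\<close>) is that the deficit plus the energy left unserved by
  the modified policy is at most the energy left unserved by the original one.  It holds at time \<open>0\<close>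
  and gives the claim because the deficit is nonnegative.

  The invariant survives one period for the following reason.  First let the modified policy copy
  the original rates, each clipped so that its own level stays within the capacity
  (\<open>copied_rate\<close>).  A charge that is cut off leaves a full store, hence no deficit there.
  A discharge that falls short reduces the deficit of that store by exactly the
  energy that is not delivered.  Copying therefore does not increase the deficit, and if it leaves a
  lower imbalance than the original step does, the deficit has fallen by at least the difference.
  From there, raising rates can only reduce the deficit, and lowering rates
  trades deficit for imbalance at a rate of at most one to one, because a unit of stored energy
  that is not charged or is discharged frees at least one unit of energy outside the store.  So all
  rates may be raised as long as the imbalance is nonnegative and lowered as long as it is
  negative.  By continuity this either reaches imbalance \<open>0\<close> or exhausts the limits on
  all rates (\<open>greedy_step_exists\<close>).  In both cases the resulting rates are greedy: at imbalance \<open>0\<close>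
  any further move gives the imbalance the wrong sign, and when the limits are exhausted
  there is no further move.  In the latter case the imbalance also has the sign that feasibility asks
  for, since all stores charging at their highest rates draw energy and all stores discharging
  at their highest rates supply it.

  The choice of the new rates only looks at the two vectors of levels, the residual energy and
  the original rates.  For a nonanticipatory original policy these are determined by what a
  nonanticipatory modification may observe.
\<close>

section \<open>Energy drawn, deficit and greedy steps\<close>

text \<open>
  Writing the energy drawn by one store as a maximum is possible because \<open>\<eta> \<le> 1\<close>; it makes
  monotonicity and continuity across rate \<open>0\<close> evident.
\<close>

definition drawn :: "real \<Rightarrow> real \<Rightarrow> real" where
  "drawn h x = max x (x / h)"

lemma drawn_nonpos: "0 < h \<Longrightarrow> h \<le> 1 \<Longrightarrow> x \<le> 0 \<Longrightarrow> drawn h x = x"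
  using mult_left_mono_neg[of h 1 x] unfolding drawn_def
  by (intro max_absorb1) (simp add: field_simps)

lemma drawn_nonneg: "0 < h \<Longrightarrow> h \<le> 1 \<Longrightarrow> 0 \<le> x \<Longrightarrow> drawn h x = x / h"
  using mult_left_mono[of h 1 x] unfolding drawn_def
  by (intro max_absorb2) (simp add: field_simps)

text \<open>
  A marginal unit of stored energy is worth at least one unit outside the store: exactly one when
  discharging, \<open>1 / h\<close> when charging.
\<close>

lemma drawn_slope_ge_1:
  assumes "0 < h" "h \<le> 1" "x \<le> y"
  shows "y - x \<le> drawn h y - drawn h x"
proof -
  have "(y - x) * h \<le> (y - x) * 1" using assms by (intro mult_left_mono) auto
  then have "y - x \<le> (y - x) / h" using assms by (simp add: pos_le_divide_eq)
  then have "x / h + (y - x) \<le> y / h" by (simp add: diff_divide_distrib)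
  then show ?thesis unfolding drawn_def by (auto simp: max_def)
qed

definition total_drawn :: "'i set \<Rightarrow> ('i \<Rightarrow> real) \<Rightarrow> ('i \<Rightarrow> real) \<Rightarrow> real" where
  "total_drawn S \<eta> \<rho> = (\<Sum>i\<in>S. drawn (\<eta> i) (\<rho> i))"

definition deficit :: "'i set \<Rightarrow> ('i \<Rightarrow> real) \<Rightarrow> ('i \<Rightarrow> real) \<Rightarrow> real" where
  "deficit S x y = (\<Sum>i\<in>S. max 0 (x i - y i))"

lemma deficit_nonneg: "0 \<le> deficit S x y"
  unfolding deficit_def by (intro sum_nonneg) auto

definition greedy_step ::
  "'i set \<Rightarrow> ('i \<Rightarrow> real) \<Rightarrow> ('i \<Rightarrow> real) \<Rightarrow> ('i \<Rightarrow> real) \<Rightarrow> ('i \<Rightarrow> real)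
     \<Rightarrow> ('i \<Rightarrow> real) \<Rightarrow> real \<Rightarrow> ('i \<Rightarrow> real) \<Rightarrow> bool" where
  "greedy_step S E P Q \<eta> y e r \<longleftrightarrow>
     feasible_step S E P Q \<eta> y e r \<and>
     (e \<ge> 0 \<longrightarrow>
        \<not> (\<exists>\<rho>. feasible_step S E P Q \<eta> y e \<rho> \<and>
              (\<forall>i\<in>S. r i \<le> \<rho> i) \<and> (\<exists>i\<in>S. r i < \<rho> i))) \<and>
     (e < 0 \<longrightarrow>
        \<not> (\<exists>\<rho>. feasible_step S E P Q \<eta> y e \<rho> \<and>
              (\<forall>i\<in>S. \<rho> i \<le> r i) \<and> (\<exists>i\<in>S. \<rho> i < r i)))"

lemma greedy_plan_iff_greedy_steps:
  "greedy_plan S E P Q \<eta> s0 re r \<longleftrightarrow>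
     (\<forall>t\<ge>1. greedy_step S E P Q \<eta> (level s0 r (t - 1)) (re t) (r t))"
  unfolding greedy_plan_def feasible_plan_def greedy_step_def by blast

text \<open>
  The relation between the original step \<open>\<rho>\<close> from levels \<open>x\<close> and the modified step \<open>\<sigma>\<close> from levels
  \<open>y\<close>; its second part is the increment of the invariant.
\<close>

definition dominating_greedy_step ::
  "'i set \<Rightarrow> ('i \<Rightarrow> real) \<Rightarrow> ('i \<Rightarrow> real) \<Rightarrow> ('i \<Rightarrow> real) \<Rightarrow> ('i \<Rightarrow> real)
     \<Rightarrow> ('i \<Rightarrow> real) \<Rightarrow> ('i \<Rightarrow> real) \<Rightarrow> real \<Rightarrow> ('i \<Rightarrow> real) \<Rightarrow> ('i \<Rightarrow> real) \<Rightarrow> bool" where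
  "dominating_greedy_step S E P Q \<eta> x y e \<rho> \<sigma> \<longleftrightarrow>
     greedy_step S E P Q \<eta> y e \<sigma> \<and>
     deficit S (\<lambda>i. x i + \<rho> i) (\<lambda>i. y i + \<sigma> i) + max 0 (- imbalance S \<eta> e \<sigma>)
       \<le> deficit S x y + max 0 (- imbalance S \<eta> e \<rho>)"

locale stores =
  fixes S :: "'i set" and E P Q \<eta> :: "'i \<Rightarrow> real"
  assumes finite_stores: "finite S"
    and discharge_limit_nonneg: "i \<in> S \<Longrightarrow> 0 \<le> P i"
    and charge_limit_nonneg: "i \<in> S \<Longrightarrow> 0 \<le> Q i"
    and efficiency: "i \<in> S \<Longrightarrow> 0 < \<eta> i \<and> \<eta> i \<le> 1"
begin

lemma imbalance_eq: "imbalance S \<eta> e \<rho> = e - total_drawn S \<eta> \<rho>"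
proof -
  have "total_drawn S \<eta> \<rho> = (\<Sum>i\<in>S. if \<rho> i < 0 then \<rho> i else \<rho> i / \<eta> i)"
    unfolding total_drawn_def
    by (intro sum.cong refl) (use efficiency in \<open>auto simp: drawn_nonpos drawn_nonneg\<close>)
  also have "\<dots> = (\<Sum>i\<in>{i\<in>S. \<rho> i < 0}. \<rho> i) + (\<Sum>i\<in>{i\<in>S. \<rho> i \<ge> 0}. \<rho> i / \<eta> i)"
    using sum.If_cases[OF finite_stores, of "\<lambda>i. \<rho> i < 0" \<rho> "\<lambda>i. \<rho> i / \<eta> i"]
    by (simp add: Int_def Collect_conj_eq[symmetric] not_less conj_commute)
  finally show ?thesis unfolding imbalance_def by simp
qed

lemma total_drawn_mono:
  assumes "\<And>i. i \<in> S \<Longrightarrow> \<rho> i \<le> \<sigma> i"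
  shows "total_drawn S \<eta> \<rho> \<le> total_drawn S \<eta> \<sigma>"
  unfolding total_drawn_def
proof (rule sum_mono)
  fix i assume "i \<in> S"
  then show "drawn (\<eta> i) (\<rho> i) \<le> drawn (\<eta> i) (\<sigma> i)"
    using drawn_slope_ge_1[of "\<eta> i" "\<rho> i" "\<sigma> i"] efficiency[of i] assms[of i] by auto
qed

lemma total_drawn_strict_mono:
  assumes "\<forall>i\<in>S. \<rho> i \<le> \<sigma> i" "\<exists>i\<in>S. \<rho> i < \<sigma> i"
  shows "total_drawn S \<eta> \<rho> < total_drawn S \<eta> \<sigma>"
proof -
  have slope: "\<sigma> i - \<rho> i \<le> drawn (\<eta> i) (\<sigma> i) - drawn (\<eta> i) (\<rho> i)" if "i \<in> S" for i
    using drawn_slope_ge_1[of "\<eta> i" "\<rho> i" "\<sigma> i"] efficiency[of i] assms(1) that by auto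
  show ?thesis unfolding total_drawn_def
  proof (rule sum_strict_mono_ex1[OF finite_stores])
    show "\<forall>i\<in>S. drawn (\<eta> i) (\<rho> i) \<le> drawn (\<eta> i) (\<sigma> i)"
      using slope assms(1) by fastforce
    show "\<exists>i\<in>S. drawn (\<eta> i) (\<rho> i) < drawn (\<eta> i) (\<sigma> i)"
      using slope assms(2) by (smt (verit))
  qed
qed

lemma total_drawn_zero: "total_drawn S \<eta> (\<lambda>i. 0) = 0"
  by (simp add: total_drawn_def drawn_def)

lemma total_drawn_intermediate_value:
  assumes le: "\<And>i. i \<in> S \<Longrightarrow> a i \<le> b i"
    and "total_drawn S \<eta> a \<le> e" "e \<le> total_drawn S \<eta> b"
  obtains \<sigma> where "\<And>i. i \<in> S \<Longrightarrow> a i \<le> \<sigma> i \<and> \<sigma> i \<le> b i" "total_drawn S \<eta> \<sigma> = e"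
proof -
  define line where "line l i = a i + l * (b i - a i)" for l :: real and i
  define f where "f l = total_drawn S \<eta> (line l)" for l
  have "continuous_on {0..1} f"
    unfolding f_def line_def total_drawn_def drawn_def
    by (intro continuous_intros) (use efficiency in fastforce)
  moreover have "line 0 = a" "line 1 = b" by (auto simp: line_def)
  then have "f 0 \<le> e" "e \<le> f 1" using assms by (simp_all add: f_def)
  ultimately obtain l where l: "0 \<le> l" "l \<le> 1" "f l = e"
    using IVT'[of f 0 e 1] by auto
  have "a i \<le> line l i \<and> line l i \<le> b i" if "i \<in> S" for i
    using l le[OF that] mult_left_le_one_le[of "b i - a i" l] by (simp add: line_def)
  with l that show thesis unfolding f_def by blast
qed

section \<open>Deficit under changes of the rates\<close>

definition copied_rate :: "('i \<Rightarrow> real) \<Rightarrow> ('i \<Rightarrow> real) \<Rightarrow> 'i \<Rightarrow> real" where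
  "copied_rate y \<rho> i = max (- y i) (min (\<rho> i) (E i - y i))"

lemma copied_rate_deficit:
  assumes y: "\<And>i. i \<in> S \<Longrightarrow> 0 \<le> y i \<and> y i \<le> E i"
    and x: "\<And>i. i \<in> S \<Longrightarrow> 0 \<le> x i + \<rho> i \<and> x i + \<rho> i \<le> E i"
  shows "deficit S (\<lambda>i. x i + \<rho> i) (\<lambda>i. y i + copied_rate y \<rho> i) \<le> deficit S x y"
  unfolding deficit_def
proof (rule sum_mono)
  fix i assume "i \<in> S"
  then show "max 0 (x i + \<rho> i - (y i + copied_rate y \<rho> i)) \<le> max 0 (x i - y i)"
    using y[of i] x[of i] by (auto simp: copied_rate_def max_def min_def)
qed

text \<open>
  A discharge that the clipping cuts short by some amount lowers both the energy delivered and the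
  deficit of the store by that amount, since the store that is copied was able to go
  deeper only by holding more.
\<close>

lemma copied_rate_deficit_plus_drawn:
  assumes y: "\<And>i. i \<in> S \<Longrightarrow> 0 \<le> y i \<and> y i \<le> E i"
    and x: "\<And>i. i \<in> S \<Longrightarrow> 0 \<le> x i + \<rho> i \<and> x i + \<rho> i \<le> E i"
  shows "deficit S (\<lambda>i. x i + \<rho> i) (\<lambda>i. y i + copied_rate y \<rho> i)
           + total_drawn S \<eta> (copied_rate y \<rho>)
         \<le> deficit S x y + total_drawn S \<eta> \<rho>"
  unfolding deficit_def total_drawn_def sum.distrib[symmetric]
proof (rule sum_mono)
  fix i assume i: "i \<in> S"
  let ?b = "copied_rate y \<rho> i"
  consider "?b = \<rho> i" | "?b = E i - y i" "?b \<le> \<rho> i" | "?b = - y i" "\<rho> i \<le> ?b"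
    using y[OF i] unfolding copied_rate_def by linarith
  then show "max 0 (x i + \<rho> i - (y i + ?b)) + drawn (\<eta> i) ?b
               \<le> max 0 (x i - y i) + drawn (\<eta> i) (\<rho> i)"
  proof cases
    case 1
    then show ?thesis by (simp add: max_def)
  next
    case 2
    have "drawn (\<eta> i) ?b \<le> drawn (\<eta> i) (\<rho> i)"
      using drawn_slope_ge_1[of "\<eta> i" ?b "\<rho> i"] efficiency[OF i] 2 by auto
    then show ?thesis using 2 x[OF i] by (auto simp: max_def)
  next
    case 3
    have "drawn (\<eta> i) ?b = ?b" "drawn (\<eta> i) (\<rho> i) = \<rho> i"
      using 3 y[OF i] efficiency[OF i] by (auto intro!: drawn_nonpos)
    then show ?thesis using 3 x[OF i] y[OF i] by (auto simp: max_def)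
  qed
qed

lemma deficit_antimono:
  assumes "\<And>i. i \<in> S \<Longrightarrow> y i \<le> z i"
  shows "deficit S x z \<le> deficit S x y"
  unfolding deficit_def by (intro sum_mono) (use assms in fastforce)

lemma lower_rates_deficit_plus_drawn:
  assumes "\<And>i. i \<in> S \<Longrightarrow> \<sigma> i \<le> \<tau> i"
  shows "deficit S z (\<lambda>i. y i + \<sigma> i) + total_drawn S \<eta> \<sigma>
         \<le> deficit S z (\<lambda>i. y i + \<tau> i) + total_drawn S \<eta> \<tau>"
  unfolding deficit_def total_drawn_def sum.distrib[symmetric]
proof (rule sum_mono)
  fix i assume i: "i \<in> S"
  show "max 0 (z i - (y i + \<sigma> i)) + drawn (\<eta> i) (\<sigma> i)
          \<le> max 0 (z i - (y i + \<tau> i)) + drawn (\<eta> i) (\<tau> i)"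
    using drawn_slope_ge_1[of "\<eta> i" "\<sigma> i" "\<tau> i"] efficiency[OF i] assms[OF i]
    by (auto simp: max_def)
qed

section \<open>One greedy step\<close>

definition lowest_rate :: "('i \<Rightarrow> real) \<Rightarrow> 'i \<Rightarrow> real" where
  "lowest_rate y i = max (- P i) (- y i)"

definition highest_rate :: "('i \<Rightarrow> real) \<Rightarrow> 'i \<Rightarrow> real" where
  "highest_rate y i = min (\<eta> i * Q i) (E i - y i)"

lemma feasible_step_iff:
  "feasible_step S E P Q \<eta> y e \<sigma> \<longleftrightarrow>
     (\<forall>i\<in>S. lowest_rate y i \<le> \<sigma> i \<and> \<sigma> i \<le> highest_rate y i) \<and>
     (0 \<le> e \<longrightarrow> total_drawn S \<eta> \<sigma> \<le> e) \<and> (e \<le> 0 \<longrightarrow> e \<le> total_drawn S \<eta> \<sigma>)"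
  unfolding feasible_step_def imbalance_eq lowest_rate_def highest_rate_def
  by (auto simp: algebra_simps)

lemma greedy_step_if_balanced:
  assumes "\<And>i. i \<in> S \<Longrightarrow> lowest_rate y i \<le> \<sigma> i \<and> \<sigma> i \<le> highest_rate y i"
    and "total_drawn S \<eta> \<sigma> = e"
  shows "greedy_step S E P Q \<eta> y e \<sigma>"
  using assms total_drawn_strict_mono[of \<sigma>] total_drawn_strict_mono[of _ \<sigma>]
  unfolding greedy_step_def feasible_step_iff by (smt (verit))

lemma greedy_step_highest:
  assumes y: "\<And>i. i \<in> S \<Longrightarrow> 0 \<le> y i \<and> y i \<le> E i"
    and drawn: "total_drawn S \<eta> (highest_rate y) \<le> e"
  shows "greedy_step S E P Q \<eta> y e (highest_rate y)"
proof -
  have "0 \<le> highest_rate y i" "lowest_rate y i \<le> 0" if "i \<in> S" for i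
    using y[OF that] efficiency[OF that] charge_limit_nonneg[OF that] discharge_limit_nonneg[OF that]
    by (auto simp: highest_rate_def lowest_rate_def)
  moreover from this have "0 \<le> total_drawn S \<eta> (highest_rate y)"
    using total_drawn_mono[of "\<lambda>i. 0" "highest_rate y"] by (simp add: total_drawn_zero)
  ultimately show ?thesis
    using drawn unfolding greedy_step_def feasible_step_iff by (smt (verit))
qed

text \<open>
  The imbalance is negative here, so the residual energy is negative as well and lowering rates is
  the greedy direction.
\<close>

lemma greedy_step_lowest:
  assumes y: "\<And>i. i \<in> S \<Longrightarrow> 0 \<le> y i \<and> y i \<le> E i"
    and drawn: "e < total_drawn S \<eta> (lowest_rate y)"
  shows "greedy_step S E P Q \<eta> y e (lowest_rate y)"
proof -
  have "0 \<le> highest_rate y i" "lowest_rate y i \<le> 0" if "i \<in> S" for i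
    using y[OF that] efficiency[OF that] charge_limit_nonneg[OF that] discharge_limit_nonneg[OF that]
    by (auto simp: highest_rate_def lowest_rate_def)
  moreover from this have "total_drawn S \<eta> (lowest_rate y) \<le> 0"
    using total_drawn_mono[of "lowest_rate y" "\<lambda>i. 0"] by (simp add: total_drawn_zero)
  ultimately show ?thesis
    using drawn unfolding greedy_step_def feasible_step_iff by (smt (verit))
qed

lemma greedy_step_exists:
  assumes y: "\<And>i. i \<in> S \<Longrightarrow> 0 \<le> y i \<and> y i \<le> E i"
    and \<rho>: "feasible_step S E P Q \<eta> x e \<rho>"
  shows "\<exists>\<sigma>. dominating_greedy_step S E P Q \<eta> x y e \<rho> \<sigma>"
proof -
  let ?D = "\<lambda>\<sigma>. deficit S (\<lambda>i. x i + \<rho> i) (\<lambda>i. y i + \<sigma> i)"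
  let ?C = "total_drawn S \<eta>"
  define b where "b = copied_rate y \<rho>"
  have x: "0 \<le> x i + \<rho> i \<and> x i + \<rho> i \<le> E i" if "i \<in> S" for i
    using \<rho> that unfolding feasible_step_def by blast
  have Db: "?D b \<le> deficit S x y" and DCb: "?D b + ?C b \<le> deficit S x y + ?C \<rho>"
    using copied_rate_deficit[OF y x] copied_rate_deficit_plus_drawn[OF y x] unfolding b_def
    by blast+
  have box: "lowest_rate y i \<le> b i \<and> b i \<le> highest_rate y i" if "i \<in> S" for i
  proof -
    have "- P i \<le> \<rho> i" "\<rho> i \<le> \<eta> i * Q i" "0 \<le> \<eta> i * Q i"
      using \<rho> efficiency[OF that] charge_limit_nonneg[OF that] that
      unfolding feasible_step_def by auto
    then show ?thesis
      using y[OF that] discharge_limit_nonneg[OF that]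
      unfolding b_def copied_rate_def lowest_rate_def highest_rate_def by auto
  qed
  have up: "?D \<sigma> \<le> deficit S x y" if "\<And>i. i \<in> S \<Longrightarrow> b i \<le> \<sigma> i" for \<sigma>
    by (rule order_trans[OF deficit_antimono Db]) (simp add: that)
  have down: "?D \<sigma> + ?C \<sigma> \<le> deficit S x y + ?C \<rho>" if "\<And>i. i \<in> S \<Longrightarrow> \<sigma> i \<le> b i" for \<sigma>
    by (rule order_trans[OF lower_rates_deficit_plus_drawn DCb]) (rule that)
  have "\<exists>\<sigma>. greedy_step S E P Q \<eta> y e \<sigma> \<and>
          ?D \<sigma> + max 0 (?C \<sigma> - e) \<le> deficit S x y + max 0 (?C \<rho> - e)"
  proof (cases "?C b \<le> e")
    case True
    show ?thesis
    proof (cases "?C (highest_rate y) \<le> e")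
      case True
      then show ?thesis
        using greedy_step_highest[OF y True] up[of "highest_rate y"] box
        by (intro exI[of _ "highest_rate y"]) auto
    next
      case False
      then obtain \<sigma> where \<sigma>: "\<And>i. i \<in> S \<Longrightarrow> b i \<le> \<sigma> i \<and> \<sigma> i \<le> highest_rate y i" "?C \<sigma> = e"
        using total_drawn_intermediate_value[of b "highest_rate y" e] box \<open>?C b \<le> e\<close> by auto
      moreover from \<sigma> have "greedy_step S E P Q \<eta> y e \<sigma>"
        using box by (intro greedy_step_if_balanced) (auto intro: order_trans)
      ultimately show ?thesis using up[of \<sigma>] by (intro exI[of _ \<sigma>]) auto
    qed
  next
    case False
    show ?thesis
    proof (cases "e < ?C (lowest_rate y)")
      case True
      then show ?thesis
        using greedy_step_lowest[OF y True] down[of "lowest_rate y"] box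
        by (intro exI[of _ "lowest_rate y"]) auto
    next
      case not_below: False
      then obtain \<sigma> where \<sigma>: "\<And>i. i \<in> S \<Longrightarrow> lowest_rate y i \<le> \<sigma> i \<and> \<sigma> i \<le> b i" "?C \<sigma> = e"
        using total_drawn_intermediate_value[of "lowest_rate y" b e] box False by auto
      moreover from \<sigma> have "greedy_step S E P Q \<eta> y e \<sigma>"
        using box by (intro greedy_step_if_balanced) (auto intro: order_trans)
      ultimately show ?thesis using down[of \<sigma>] by (intro exI[of _ \<sigma>]) auto
    qed
  qed
  then show ?thesis unfolding dominating_greedy_step_def imbalance_eq by simp
qed

text \<open>
  Levels and rates outside \<open>S\<close> are junk values on which no admissible decision may depend.
\<close>

lemma dominating_greedy_step_cong:
  assumes "\<And>i. i \<in> S \<Longrightarrow> x i = x' i" "\<And>i. i \<in> S \<Longrightarrow> y i = y' i" "\<And>i. i \<in> S \<Longrightarrow> \<rho> i = \<rho>' i"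
  shows "dominating_greedy_step S E P Q \<eta> x y e \<rho> = dominating_greedy_step S E P Q \<eta> x' y' e \<rho>'"
proof -
  have "feasible_step S E P Q \<eta> y e = feasible_step S E P Q \<eta> y' e"
    using assms(2) by (auto simp: feasible_step_def fun_eq_iff)
  moreover have "deficit S (\<lambda>i. x i + \<rho> i) (\<lambda>i. y i + \<sigma> i)
      = deficit S (\<lambda>i. x' i + \<rho>' i) (\<lambda>i. y' i + \<sigma> i)" for \<sigma>
    unfolding deficit_def using assms by (intro sum.cong) auto
  moreover have "deficit S x y = deficit S x' y'"
    unfolding deficit_def using assms by (intro sum.cong) auto
  moreover have "total_drawn S \<eta> \<rho> = total_drawn S \<eta> \<rho>'"
    unfolding total_drawn_def using assms by (intro sum.cong) auto
  ultimately show ?thesis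
    unfolding dominating_greedy_step_def greedy_step_def imbalance_eq fun_eq_iff by simp
qed

section \<open>The modified policy\<close>

definition greedy_choice ::
  "('i \<Rightarrow> real) \<Rightarrow> ('i \<Rightarrow> real) \<Rightarrow> real \<Rightarrow> ('i \<Rightarrow> real) \<Rightarrow> 'i \<Rightarrow> real" where
  "greedy_choice x y e \<rho> = (SOME \<sigma>. dominating_greedy_step S E P Q \<eta> x y e \<rho> \<sigma>)"

text \<open>
  The recursion is over the levels, because the rates at one time depend on the earlier rates only
  through them.
\<close>

primrec greedy_levels ::
  "('i \<Rightarrow> real) \<Rightarrow> (nat \<Rightarrow> real) \<Rightarrow> 'i plan \<Rightarrow> nat \<Rightarrow> 'i \<Rightarrow> real" where
  "greedy_levels s0 re r 0 = s0"
| "greedy_levels s0 re r (Suc t) = (\<lambda>i. greedy_levels s0 re r t i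
     + greedy_choice (level s0 r t) (greedy_levels s0 re r t) (re (Suc t)) (r (Suc t)) i)"

definition greedy_modification ::
  "('i \<Rightarrow> real) \<Rightarrow> (nat \<Rightarrow> real) \<Rightarrow> 'i plan \<Rightarrow> 'i plan" where
  "greedy_modification s0 re r t =
     greedy_choice (level s0 r (t - 1)) (greedy_levels s0 re r (t - 1)) (re t) (r t)"

lemma level_greedy_modification:
  "level s0 (greedy_modification s0 re r) t = greedy_levels s0 re r t"
  by (induction t) (auto simp: greedy_modification_def)

lemma greedy_modification_eq:
  "greedy_modification s0 re r t = greedy_choice (level s0 r (t - 1))
     (level s0 (greedy_modification s0 re r) (t - 1)) (re t) (r t)"
  unfolding level_greedy_modification by (rule greedy_modification_def)

lemma greedy_modification_invariant:
  assumes s0: "\<And>i. i \<in> S \<Longrightarrow> 0 \<le> s0 i \<and> s0 i \<le> E i"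
    and r: "feasible_plan S E P Q \<eta> s0 re r"
  defines "r' \<equiv> greedy_modification s0 re r"
  shows "dominating_greedy_step S E P Q \<eta> (level s0 r t) (level s0 r' t)
           (re (Suc t)) (r (Suc t)) (r' (Suc t))"
    and "deficit S (level s0 r t) (level s0 r' t) + unserved S \<eta> re r' t \<le> unserved S \<eta> re r t"
proof -
  have step: "dominating_greedy_step S E P Q \<eta> (level s0 r t) (level s0 r' t)
      (re (Suc t)) (r (Suc t)) (r' (Suc t))"
    if "\<forall>i\<in>S. 0 \<le> level s0 r' t i \<and> level s0 r' t i \<le> E i" for t
  proof -
    have "feasible_step S E P Q \<eta> (level s0 r t) (re (Suc t)) (r (Suc t))"
      using r unfolding feasible_plan_def by (metis diff_Suc_1 le_add1 plus_1_eq_Suc)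
    then have "\<exists>\<sigma>. dominating_greedy_step S E P Q \<eta> (level s0 r t) (level s0 r' t)
        (re (Suc t)) (r (Suc t)) \<sigma>"
      using that by (intro greedy_step_exists) auto
    then show ?thesis
      unfolding r'_def greedy_modification_eq[of _ _ _ "Suc t"] greedy_choice_def diff_Suc_1
      by (rule someI_ex)
  qed
  have bounds: "\<forall>i\<in>S. 0 \<le> level s0 r' t i \<and> level s0 r' t i \<le> E i" for t
  proof (induction t)
    case 0
    then show ?case using s0 by simp
  next
    case (Suc t)
    from step[OF this] show ?case
      unfolding dominating_greedy_step_def greedy_step_def feasible_step_def by simp
  qed
  show "dominating_greedy_step S E P Q \<eta> (level s0 r t) (level s0 r' t)
      (re (Suc t)) (r (Suc t)) (r' (Suc t))"
    by (rule step[OF bounds])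
  show "deficit S (level s0 r t) (level s0 r' t) + unserved S \<eta> re r' t \<le> unserved S \<eta> re r t"
  proof (induction t)
    case 0
    then show ?case by (simp add: deficit_def unserved_def)
  next
    case (Suc t)
    then show ?case
      using step[OF bounds, of t] unfolding dominating_greedy_step_def unserved_def by simp
  qed
qed

end

theorem proposition1:
  fixes S :: "'i set" and E P Q \<eta> s0 :: "'i \<Rightarrow> real"
    and R :: "(nat \<Rightarrow> real) set" and \<pi> :: "'i policy"
  assumes "finite S"
    and "\<And>i. i \<in> S \<Longrightarrow> E i > 0"
    and "\<And>i. i \<in> S \<Longrightarrow> P i > 0"
    and "\<And>i. i \<in> S \<Longrightarrow> Q i > 0"
    and "\<And>i. i \<in> S \<Longrightarrow> 0 < \<eta> i \<and> \<eta> i \<le> 1"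
    and "\<And>i. i \<in> S \<Longrightarrow> 0 \<le> s0 i \<and> s0 i \<le> E i"
    and "feasible_policy S E P Q \<eta> s0 R \<pi>"
  shows "\<exists>\<pi>'. greedy_policy S E P Q \<eta> s0 R \<pi>' \<and>
           (\<forall>re\<in>R. \<forall>t\<ge>1. unserved S \<eta> re (\<pi>' re) t \<le> unserved S \<eta> re (\<pi> re) t) \<and>
           (nonanticipatory S s0 R \<pi> \<longrightarrow> nonanticipatory_modification S s0 R \<pi> \<pi>')"
proof -
  interpret stores S E P Q \<eta>
    using assms(1,3-5) by unfold_locales (auto intro: less_imp_le)
  define \<pi>' where "\<pi>' re = greedy_modification s0 re (\<pi> re)" for re
  have feasible: "feasible_plan S E P Q \<eta> s0 re (\<pi> re)" if "re \<in> R" for re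
    using assms(7) that unfolding feasible_policy_def by blast
  note invariant = greedy_modification_invariant[OF assms(6) feasible, folded \<pi>'_def]
  have "greedy_policy S E P Q \<eta> s0 R \<pi>'"
    unfolding greedy_policy_def greedy_plan_iff_greedy_steps
  proof (intro ballI allI impI)
    fix re and t :: nat
    assume "re \<in> R" "1 \<le> t"
    then show "greedy_step S E P Q \<eta> (level s0 (\<pi>' re) (t - 1)) (re t) (\<pi>' re t)"
      using invariant(1)[of re "t - 1"] unfolding dominating_greedy_step_def by simp
  qed
  moreover have "unserved S \<eta> re (\<pi>' re) t \<le> unserved S \<eta> re (\<pi> re) t" if "re \<in> R" for re t
    using invariant(2)[OF _ that, of t] deficit_nonneg[of S "level s0 (\<pi> re) t" "level s0 (\<pi>' re) t"]
    by linarith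
  moreover have "nonanticipatory_modification S s0 R \<pi> \<pi>'" if "nonanticipatory S s0 R \<pi>"
    unfolding nonanticipatory_modification_def nonanticipatory_wrt_def
  proof (intro allI impI ballI, elim conjE)
    fix t re re' i
    assume t: "1 \<le> t" and re: "re \<in> R" "re' \<in> R" "re t = re' t"
      and levels: "\<forall>\<sigma>\<in>{\<pi>, \<pi>'}. \<forall>i\<in>S. level s0 (\<sigma> re) (t - 1) i = level s0 (\<sigma> re') (t - 1) i"
    have "\<forall>i\<in>S. \<pi> re t i = \<pi> re' t i"
      using \<open>nonanticipatory S s0 R \<pi>\<close> t re levels
      unfolding nonanticipatory_def nonanticipatory_wrt_def by blast
    then have "greedy_choice (level s0 (\<pi> re) (t - 1)) (level s0 (\<pi>' re) (t - 1)) (re t) (\<pi> re t)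
      = greedy_choice (level s0 (\<pi> re') (t - 1)) (level s0 (\<pi>' re') (t - 1)) (re t) (\<pi> re' t)"
      unfolding greedy_choice_def using levels
      by (intro arg_cong[where f = Eps] dominating_greedy_step_cong) auto
    then have "\<pi>' re t = \<pi>' re' t"
      using re greedy_modification_eq[of s0 re "\<pi> re" t] greedy_modification_eq[of s0 re' "\<pi> re'" t]
      unfolding \<pi>'_def by simp
    then show "\<pi>' re t i = \<pi>' re' t i" by simp
  qed
  ultimately show ?thesis by blast
qed

end
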